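(* Any $5$-dimensional almost abelian Lie algebra admitting a coKähler structure is isomorphic to one and only one of the following: - $\mathbb{R}^5$ (abelian); - $\mathfrak{g}_{1,0}:=\mathbb{R}\xi\ltimes_{R(1)\oplus R(0)}\mathbb{R}^4$; - $\mathfrak{g}_{1,\alpha}:=\mathbb{R}\xi\ltimes_{R(1)\oplus R(\alpha)}\mathbb{R}^4$, $\alpha\in(0,1]$; - $\mathbb{R}\xi\times\mathfrak{rr}_{3,0}$; - $\mathbb{R}\xi\times\mathfrak{r}'_{4,0,\lambda}$, $\lambda>0$. (Different values of the parameters give non-isomorphic Lie algebras.)
   Context: All Lie algebras are real. A Lie algebra is almost abelian if it has an abelian ideal of codimension one. $\mathbb{R}x\ltimes_A\mathbb{R}^d$ denotes the Lie algebra with abelian ideal $\mathbb{R}^d$ and $\mathrm{ad}_x|_{\mathbb{R}^d}=A$. Notation: $R(\lambda)=\begin{pmatrix}0&-\lambda\\ \lambda&0\end{pmatrix}$, and $\oplus$ denotes the block-diagonal sum of matrices, with a scalar $c$ viewed as a $1\times1$ block. The four-dimensional Lie algebras are $\mathfrak{rr}_{3,0}=\mathbb{R}h_0\ltimes_{1\oplus R(0)}\mathbb{R}^3$ and $\mathfrak{r}'_{4,0,\lambda}=\mathbb{R}h_0\ltimes_{1\oplus R(\lambda)}\mathbb{R}^3$ for $\lambda>0$. $\mathbb{R}\xi\times\mathfrak{h}$ is the direct product with a one-dimensional Lie algebra. CoKähler structure on a Lie algebra $\mathfrak{g}$ of odd dimension: a quadruple $(J,\xi,\alpha,\langle\cdot,\cdot\rangle)$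 with $J$ an endomorphism of $\mathfrak{g}$, $\xi\in\mathfrak{g}$ non-zero, $\alpha\in\mathfrak{g}^*$ and $\langle\cdot,\cdot\rangle$ an inner product such that $\alpha(\xi)=1$, $J^2=-\mathrm{Id}+\alpha\otimes\xi$, $\langle JX,JY\rangle=\langle X,Y\rangle-\alpha(X)\alpha(Y)$, $d\alpha=0$, $N_J=0$, $d\omega=0$, where $\omega(X,Y)=\langle JX,Y\rangle$, $d$ is the Chevalley–Eilenberg differential and $N_J(X,Y)=[JX,JY]-J[JX,Y]-J[X,JY]+J^2[X,Y]$. *)

theory Defs
  imports "HOL-Analysis.Analysis"
begin

section \<open>Real Lie algebras\<close>

text \<open>A real Lie algebra is given by a bracket on a whole type of class
  \<open>real_vector\<close>; its dimension is \<open>dim UNIV\<close> (which is \<open>0\<close> when there is no finite basis).\<close>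

definition lie_algebra :: "('a::real_vector \<Rightarrow> 'a \<Rightarrow> 'a) \<Rightarrow> bool" where
  "lie_algebra br \<longleftrightarrow>
     bilinear br \<and>
     (\<forall>x. br x x = 0) \<and>
     (\<forall>x y z. br x (br y z) + br y (br z x) + br z (br x y) = 0)"

definition lie_isomorphic ::
    "('a::real_vector \<Rightarrow> 'a \<Rightarrow> 'a) \<Rightarrow> ('b::real_vector \<Rightarrow> 'b \<Rightarrow> 'b) \<Rightarrow> bool" where
  "lie_isomorphic br br' \<longleftrightarrow>
     (\<exists>f. linear f \<and> bij f \<and> (\<forall>x y. f (br x y) = br' (f x) (f y)))"

definition lie_ideal :: "('a::real_vector \<Rightarrow> 'a \<Rightarrow> 'a) \<Rightarrow> 'a set \<Rightarrow> bool" where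
  "lie_ideal br I \<longleftrightarrow> subspace I \<and> (\<forall>x. \<forall>y\<in>I. br x y \<in> I)"

text \<open>Codimension one is expressed by \<open>dim\<close>, so this is meant for finite-dimensional algebras.\<close>

definition almost_abelian :: "('a::real_vector \<Rightarrow> 'a \<Rightarrow> 'a) \<Rightarrow> bool" where
  "almost_abelian br \<longleftrightarrow>
     (\<exists>I. lie_ideal br I \<and> (\<forall>x\<in>I. \<forall>y\<in>I. br x y = 0) \<and>
          dim (UNIV :: 'a set) = dim I + 1)"

section \<open>CoKaehler structures\<close>

definition inner_product :: "('a::real_vector \<Rightarrow> 'a \<Rightarrow> real) \<Rightarrow> bool" where
  "inner_product g \<longleftrightarrow>
     bilinear g \<and> (\<forall>x y. g x y = g y x) \<and> (\<forall>x. x \<noteq> 0 \<longrightarrow> g x x > 0)"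

text \<open>The Chevalley--Eilenberg differential with trivial real coefficients, on 1-forms and
  on 2-forms.\<close>

definition ce_d1 :: "('a \<Rightarrow> 'a \<Rightarrow> 'a) \<Rightarrow> ('a \<Rightarrow> real) \<Rightarrow> 'a \<Rightarrow> 'a \<Rightarrow> real" where
  "ce_d1 br \<eta> x y = - \<eta> (br x y)"

definition ce_d2 ::
    "('a \<Rightarrow> 'a \<Rightarrow> 'a) \<Rightarrow> ('a \<Rightarrow> 'a \<Rightarrow> real) \<Rightarrow> 'a \<Rightarrow> 'a \<Rightarrow> 'a \<Rightarrow> real" where
  "ce_d2 br \<eta> x y z = - \<eta> (br x y) z + \<eta> (br x z) y - \<eta> (br y z) x"

definition nijenhuis ::
    "('a::real_vector \<Rightarrow> 'a \<Rightarrow> 'a) \<Rightarrow> ('a \<Rightarrow> 'a) \<Rightarrow> 'a \<Rightarrow> 'a \<Rightarrow> 'a" where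
  "nijenhuis br J x y = br (J x) (J y) - J (br (J x) y) - J (br x (J y)) + J (J (br x y))"

definition cokaehler_structure ::
    "('a::real_vector \<Rightarrow> 'a \<Rightarrow> 'a) \<Rightarrow> ('a \<Rightarrow> 'a) \<Rightarrow> 'a \<Rightarrow> ('a \<Rightarrow> real) \<Rightarrow>
       ('a \<Rightarrow> 'a \<Rightarrow> real) \<Rightarrow> bool" where
  "cokaehler_structure br J \<xi> \<alpha> g \<longleftrightarrow>
     odd (dim (UNIV :: 'a set)) \<and>
     linear J \<and> \<xi> \<noteq> 0 \<and> linear \<alpha> \<and> inner_product g \<and>
     \<alpha> \<xi> = 1 \<and>
     (\<forall>x. J (J x) = - x + \<alpha> x *\<^sub>R \<xi>) \<and>
     (\<forall>x y. g (J x) (J y) = g x y - \<alpha> x * \<alpha> y) \<and>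
     (\<forall>x y. ce_d1 br \<alpha> x y = 0) \<and>
     (\<forall>x y. nijenhuis br J x y = 0) \<and>
     (\<forall>x y z. ce_d2 br (\<lambda>u v. g (J u) v) x y z = 0)"

definition admits_cokaehler :: "('a::real_vector \<Rightarrow> 'a \<Rightarrow> 'a) \<Rightarrow> bool" where
  "admits_cokaehler br \<longleftrightarrow> (\<exists>J \<xi> \<alpha> g. cokaehler_structure br J \<xi> \<alpha> g)"

section \<open>The Lie algebras of the list\<close>

definition abelian_bracket :: "'a::real_vector \<Rightarrow> 'a \<Rightarrow> 'a" where
  "abelian_bracket x y = 0"

text \<open>In \<open>real \<times> (real ^ 'd)\<close> the first component is the coefficient of the acting vector.\<close>

definition semidirect_bracket ::
    "real ^ 'd ^ 'd \<Rightarrow> real \<times> (real ^ 'd) \<Rightarrow> real \<times> (real ^ 'd) \<Rightarrow> real \<times> (real ^ 'd)" where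
  "semidirect_bracket A = (\<lambda>(s, u) (t, v). (0, s *\<^sub>R (A *v v) - t *\<^sub>R (A *v u)))"

definition product_bracket ::
    "('a \<Rightarrow> 'a \<Rightarrow> 'a) \<Rightarrow> ('b \<Rightarrow> 'b \<Rightarrow> 'b) \<Rightarrow> 'a \<times> 'b \<Rightarrow> 'a \<times> 'b \<Rightarrow> 'a \<times> 'b" where
  "product_bracket br br' = (\<lambda>(x, u) (y, v). (br x y, br' u v))"

definition R_mat :: "real \<Rightarrow> real ^ 2 ^ 2" where
  "R_mat l = vector [vector [0, - l], vector [l, 0]]"

text \<open>Block-diagonal sums are indexed by the sum of the index types, so
  \<open>real ^ (1 + 2)\<close> plays the role of three-space and \<open>real ^ (2 + 2)\<close> that of four-space.\<close>

definition block_diag ::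
    "real ^ 'm ^ 'm \<Rightarrow> real ^ 'n ^ 'n \<Rightarrow> real ^ ('m + 'n) ^ ('m + 'n)" (infixr "\<oplus>\<^sub>m" 65) where
  "A \<oplus>\<^sub>m B = (\<chi> i j. case (i, j) of
      (Inl a, Inl b) \<Rightarrow> A $ a $ b
    | (Inr a, Inr b) \<Rightarrow> B $ a $ b
    | _ \<Rightarrow> 0)"

definition rr30 :: "real \<times> (real ^ (1 + 2)) \<Rightarrow> real \<times> (real ^ (1 + 2)) \<Rightarrow> real \<times> (real ^ (1 + 2))" where
  "rr30 = semidirect_bracket ((mat 1 :: real ^ 1 ^ 1) \<oplus>\<^sub>m R_mat 0)"

definition r'40 ::
    "real \<Rightarrow> real \<times> (real ^ (1 + 2)) \<Rightarrow> real \<times> (real ^ (1 + 2)) \<Rightarrow> real \<times> (real ^ (1 + 2))" where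
  "r'40 l = semidirect_bracket ((mat 1 :: real ^ 1 ^ 1) \<oplus>\<^sub>m R_mat l)"

definition g1 ::
    "real \<Rightarrow> real \<times> (real ^ (2 + 2)) \<Rightarrow> real \<times> (real ^ (2 + 2)) \<Rightarrow> real \<times> (real ^ (2 + 2))" where
  "g1 a = semidirect_bracket (R_mat 1 \<oplus>\<^sub>m R_mat a)"

definition R_times ::
    "('b::real_vector \<Rightarrow> 'b \<Rightarrow> 'b) \<Rightarrow> real \<times> 'b \<Rightarrow> real \<times> 'b \<Rightarrow> real \<times> 'b" where
  "R_times br = product_bracket abelian_bracket br"

text \<open>The entries of the list live on different types, so they are referred to by labels:
  a label is admissible when its parameter is in the prescribed range, and \<open>isomorphic_to\<close>
  compares a Lie algebra with the one a label stands for.\<close>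

datatype label = Abelian5 | G10 | G1 real | R_times_rr30 | R_times_r'40 real

fun admissible :: "label \<Rightarrow> bool" where
  "admissible Abelian5 \<longleftrightarrow> True"
| "admissible G10 \<longleftrightarrow> True"
| "admissible (G1 a) \<longleftrightarrow> 0 < a \<and> a \<le> 1"
| "admissible R_times_rr30 \<longleftrightarrow> True"
| "admissible (R_times_r'40 l) \<longleftrightarrow> 0 < l"

fun isomorphic_to :: "('a::real_vector \<Rightarrow> 'a \<Rightarrow> 'a) \<Rightarrow> label \<Rightarrow> bool" where
  "isomorphic_to br Abelian5 \<longleftrightarrow> lie_isomorphic br (abelian_bracket :: real ^ 5 \<Rightarrow> _)"
| "isomorphic_to br G10 \<longleftrightarrow> lie_isomorphic br (g1 0)"
| "isomorphic_to br (G1 a) \<longleftrightarrow> lie_isomorphic br (g1 a)"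
| "isomorphic_to br R_times_rr30 \<longleftrightarrow> lie_isomorphic br (R_times rr30)"
| "isomorphic_to br (R_times_r'40 l) \<longleftrightarrow> lie_isomorphic br (R_times (r'40 l))"

end

theory Submission
  imports Defs
begin

text \<open>Let \<open>I\<close> be the abelian ideal of codimension one and \<open>K = ker \<alpha>\<close>, which contains the derived
  algebra. Closedness of \<open>\<omega>\<close> and \<open>N\<^sub>J = 0\<close> make \<open>ad \<xi>\<close> commute with \<open>J\<close> and act skew-symmetrically on
  \<open>K\<close>. If \<open>I = K\<close>, then \<open>ad \<xi>\<close> is skew-Hermitian on the complex plane \<open>K\<close> and can be diagonalised.
  Otherwise let \<open>e \<in> K\<close> be orthogonal to \<open>I \<inter> K\<close>; the same two identities force \<open>ad e\<close> to scale
  \<open>J e\<close> and to rotate the complex line orthogonal to \<open>e\<close> and \<open>J e\<close>, and a suitable \<open>\<xi> + t e\<close> is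
  central. Rescaling the acting vector gives the list. Its members are told apart by the nonzero
  eigenvalues of the squares \<open>(ad x)\<^sup>2\<close>, up to a common positive factor, except for \<open>g\<^bsub>1,0\<^esub>\<close> and
  \<open>g\<^bsub>1,1\<^esub>\<close>, where the centre decides.\<close>

section \<open>Isomorphisms and the five-dimensional models\<close>

lemma lie_isomorphicI:
  assumes "linear f" "\<And>x. h (f x) = x" "\<And>y. f (h y) = y"
    and "\<And>x y. f (br x y) = br' (f x) (f y)"
  shows "lie_isomorphic br br'"
  unfolding lie_isomorphic_def
  using assms by (intro exI[of _ f]) (auto intro!: o_bij[of h f])

lemma lie_isomorphic_refl: "lie_isomorphic br br"
  by (rule lie_isomorphicI[of id id]) (auto simp: linear_id)

lemma lie_isomorphic_sym:
  assumes "lie_isomorphic br br'"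
  shows "lie_isomorphic br' br"
proof -
  obtain f where f: "linear f" "bij f" "\<And>x y. f (br x y) = br' (f x) (f y)"
    using assms unfolding lie_isomorphic_def by auto
  have inj: "inj f" and surj: "surj f"
    using f(2) by (auto simp: bij_def)
  have fi: "f (inv f y) = y" "inv f (f x) = x" for x y
    using inj surj by (auto simp: surj_f_inv_f)
  have "linear (inv f)"
  proof (rule linearI)
    show "inv f (x + y) = inv f x + inv f y" for x y
      using fi linear_add[OF f(1)] by metis
    show "inv f (r *\<^sub>R x) = r *\<^sub>R inv f x" for r x
      using fi linear_scale[OF f(1)] by metis
  qed
  moreover have "inv f (br' x y) = br (inv f x) (inv f y)" for x y
    using fi f(3) by metis
  ultimately show ?thesis
    using fi by (intro lie_isomorphicI[of "inv f" f]) auto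
qed

lemma lie_isomorphic_trans:
  assumes "lie_isomorphic br br'" "lie_isomorphic br' br''"
  shows "lie_isomorphic br br''"
proof -
  obtain f where f: "linear f" "bij f" "\<And>x y. f (br x y) = br' (f x) (f y)"
    using assms(1) unfolding lie_isomorphic_def by auto
  obtain h where h: "linear h" "bij h" "\<And>x y. h (br' x y) = br'' (h x) (h y)"
    using assms(2) unfolding lie_isomorphic_def by auto
  show ?thesis
    unfolding lie_isomorphic_def
    using f h by (intro exI[of _ "h \<circ> f"]) (auto simp: linear_compose bij_comp)
qed

lemma lie_isomorphic_cong:
  assumes "lie_isomorphic m m'"
  shows "lie_isomorphic br m \<longleftrightarrow> lie_isomorphic br m'"
  using assms lie_isomorphic_trans[of br m m'] lie_isomorphic_trans[of br m' m]
    lie_isomorphic_sym[of m m'] by metis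

section \<open>Coordinate models and the isomorphisms between them\<close>

type_synonym tuple5 = "real \<times> real \<times> real \<times> real \<times> real"

text \<open>The semidirect product of the line with four-space in which the acting vector has the
  matrix \<open>((p, -a), (a, 0)) \<oplus> R(b)\<close>; every algebra of the list is of this form with \<open>p * a = 0\<close>.\<close>

definition model_bracket :: "real \<Rightarrow> real \<Rightarrow> real \<Rightarrow> tuple5 \<Rightarrow> tuple5 \<Rightarrow> tuple5" where
  "model_bracket p a b = (\<lambda>(s, u1, u2, u3, u4) (t, v1, v2, v3, v4).
     (0, s * (p * v1 - a * v2) - t * (p * u1 - a * u2), a * (s * v1 - t * u1),
      - b * (s * v4 - t * u4), b * (s * v3 - t * u3)))"

text \<open>Multiplying the acting vector by \<open>r\<close> multiplies its matrix by
  \<open>r\<close>; its coefficient is then divided by \<open>r\<close>.\<close>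

lemma model_bracket_scale:
  assumes "r \<noteq> 0"
  shows "lie_isomorphic (model_bracket p a b) (model_bracket (r * p) (r * a) (r * b))"
  by (rule lie_isomorphicI[of "\<lambda>(s, u). (s / r, u)" "\<lambda>(s, u). (r * s, u)"])
    (use assms in \<open>auto simp: model_bracket_def field_simps intro!: linearI\<close>)

text \<open>With \<open>p = 0\<close> both blocks are rotations, so the two planes can be
  exchanged.\<close>

lemma model_bracket_swap:
  "lie_isomorphic (model_bracket 0 a b) (model_bracket 0 b a)"
  by (rule lie_isomorphicI[of "\<lambda>(s, u1, u2, u3, u4). (s, u3, u4, u1, u2)"
        "\<lambda>(s, u1, u2, u3, u4). (s, u3, u4, u1, u2)"])
    (auto simp: model_bracket_def field_simps intro!: linearI)

text \<open>A reflection of the second plane reverses the sense of its rotation.\<close>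

lemma model_bracket_neg:
  "lie_isomorphic (model_bracket p a b) (model_bracket p a (- b))"
  by (rule lie_isomorphicI[of "\<lambda>(s, u1, u2, u3, u4). (s, u1, u2, u3, - u4)"
        "\<lambda>(s, u1, u2, u3, u4). (s, u1, u2, u3, - u4)"])
    (auto simp: model_bracket_def field_simps intro!: linearI)

lemma model_bracket_abs:
  "lie_isomorphic (model_bracket p a b) (model_bracket p a \<bar>b\<bar>)"
  using model_bracket_neg[of p a b] lie_isomorphic_refl by (auto simp: abs_if)

fun model_of :: "label \<Rightarrow> tuple5 \<Rightarrow> tuple5 \<Rightarrow> tuple5" where
  "model_of Abelian5 = model_bracket 0 0 0"
| "model_of G10 = model_bracket 0 1 0"
| "model_of (G1 a) = model_bracket 0 1 a"
| "model_of R_times_rr30 = model_bracket 1 0 0"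
| "model_of (R_times_r'40 l) = model_bracket 1 0 l"

section \<open>From block matrices to coordinate models\<close>

lemma sum_UNIV_Plus:
  "(\<Sum>j\<in>(UNIV :: ('m::finite + 'n::finite) set). f j) =
     (\<Sum>j\<in>UNIV. f (Inl j)) + (\<Sum>j\<in>UNIV. f (Inr j) :: real)"
  unfolding UNIV_Plus_UNIV[symmetric] by (subst sum.Plus) auto

lemma forall_Plus: "(\<forall>i. P i) \<longleftrightarrow> (\<forall>i. P (Inl i)) \<and> (\<forall>i. P (Inr i))"
  by (metis sum.exhaust)

lemma block_diag_mult_nth [simp]:
  "((A \<oplus>\<^sub>m B) *v v) $ Inl i = (A *v (\<chi> k. v $ Inl k)) $ i"
  "((A \<oplus>\<^sub>m B) *v v) $ Inr j = (B *v (\<chi> k. v $ Inr k)) $ j"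
  by (simp_all add: matrix_vector_mult_def block_diag_def sum_UNIV_Plus)

lemma R_mat_mult_nth [simp]:
  "(R_mat l *v v) $ 1 = - l * v $ 2" "(R_mat l *v v) $ 2 = l * v $ 1"
  by (simp_all add: matrix_vector_mult_def R_mat_def sum_2)

lemma abelian_iso_model:
  "lie_isomorphic (abelian_bracket :: real ^ 5 \<Rightarrow> _) (model_bracket 0 0 0)"
proof -
  have all5: "(\<forall>i::5. P i) \<longleftrightarrow> P 1 \<and> P 2 \<and> P 3 \<and> P 4 \<and> P 5" for P
  proof -
    \<comment> \<open>Numerals of type \<open>5\<close> are read modulo five, so the representative
      \<open>0\<close> is the index \<open>5\<close>.\<close>
    have "i = 1 \<or> i = 2 \<or> i = 3 \<or> i = 4 \<or> i = (5::5)" for i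
    proof (induct i)
      case (of_int z)
      then have "z = 0 \<or> z = 1 \<or> z = 2 \<or> z = 3 \<or> z = 4" by fastforce
      then show ?case by auto
    qed
    then show ?thesis by metis
  qed
  show ?thesis
    by (rule lie_isomorphicI[of "\<lambda>v. (v $ 1, v $ 2, v $ 3, v $ 4, v $ 5)"
        "\<lambda>(a, b, c, d, e). \<chi> i. if i = 1 then a else if i = 2 then b else if i = 3 then c
           else if i = 4 then d else e"])
      (auto simp: model_bracket_def abelian_bracket_def vec_eq_iff all5 intro!: linearI)
qed

lemma g1_iso_model: "lie_isomorphic (g1 a) (model_bracket 0 1 a)"
  by (rule lie_isomorphicI[of "\<lambda>(s, v). (s, v $ Inl 1, v $ Inl 2, v $ Inr 1, v $ Inr 2)"
        "\<lambda>(s, a, b, c, d). (s, \<chi> i. case i of Inl k \<Rightarrow> if k = 1 then a else b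
            | Inr k \<Rightarrow> if k = 1 then c else d)"])
    (auto simp: g1_def semidirect_bracket_def model_bracket_def vec_eq_iff forall_Plus forall_2
        algebra_simps zero_prod_def intro!: linearI)

text \<open>The matrix of the model has first block \<open>((1, 0), (0, 0))\<close>; its null
  direction hosts the direct factor \<open>z\<close>. The case \<open>l = 0\<close> also covers
  \<open>rr30\<close>.\<close>

lemma r'40_iso_model: "lie_isomorphic (R_times (r'40 l)) (model_bracket 1 0 l)"
  by (rule lie_isomorphicI[of "\<lambda>(z, s, v). (s, v $ Inl 1, z, v $ Inr 1, v $ Inr 2)"
        "\<lambda>(s, a, z, c, d). (z, s, \<chi> i. case i of Inl k \<Rightarrow> a | Inr k \<Rightarrow> if k = 1 then c else d)"])
    (auto simp: R_times_def product_bracket_def abelian_bracket_def r'40_def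
        semidirect_bracket_def model_bracket_def vec_eq_iff forall_Plus forall_2 forall_1
        algebra_simps intro!: linearI)

lemma isomorphic_to_iff_model: "isomorphic_to br L \<longleftrightarrow> lie_isomorphic br (model_of L)"
proof -
  have rr30: "rr30 = r'40 0"
    by (simp add: rr30_def r'40_def)
  show ?thesis
    by (cases L)
      (simp_all add: rr30 lie_isomorphic_cong[OF abelian_iso_model]
        lie_isomorphic_cong[OF g1_iso_model] lie_isomorphic_cong[OF r'40_iso_model])
qed

section \<open>The labels are distinguished by their models\<close>

text \<open>For an element acting as \<open>s B\<close> on the abelian ideal this is \<open>s\<^sup>2\<close> times the set of
  nonzero eigenvalues of \<open>B\<^sup>2\<close>.\<close>

definition ad_sq_spec :: "('a::real_vector \<Rightarrow> 'a \<Rightarrow> 'a) \<Rightarrow> 'a \<Rightarrow> real set" where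
  "ad_sq_spec br x = {k. k \<noteq> 0 \<and> (\<exists>z. z \<noteq> 0 \<and> br x (br x z) = k *\<^sub>R z)}"

text \<open>A second invariant, since the spectra of squares coincide for \<open>G10\<close> and
  \<open>G1 1\<close>.\<close>

definition has_centre :: "('a::real_vector \<Rightarrow> 'a \<Rightarrow> 'a) \<Rightarrow> bool" where
  "has_centre br \<longleftrightarrow> (\<exists>z. z \<noteq> 0 \<and> (\<forall>x. br x z = 0))"

text \<open>An isomorphism \<open>f\<close> conjugates \<open>ad x\<close> into
  \<open>ad (f x)\<close>. No element is distinguished, so the family of all spectra is
  compared.\<close>

lemma lie_isomorphic_invariants:
  assumes "lie_isomorphic br br'"
  shows "range (ad_sq_spec br) = range (ad_sq_spec br')" "has_centre br \<longleftrightarrow> has_centre br'"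
proof -
  obtain f where f: "linear f" "bij f" "\<And>x y. f (br x y) = br' (f x) (f y)"
    using assms unfolding lie_isomorphic_def by auto
  have inj: "f x = f y \<longleftrightarrow> x = y" for x y
    using f(2) by (auto simp: bij_def inj_eq)
  have surj: "\<exists>x. y = f x" for y
    using f(2) by (auto simp: bij_def surj_def)
  have f0: "f x = 0 \<longleftrightarrow> x = 0" for x
    using inj[of x 0] linear_0[OF f(1)] by simp
  have "br' (f x) (br' (f x) (f z)) = k *\<^sub>R f z \<longleftrightarrow> br x (br x z) = k *\<^sub>R z" for x k z
    using inj[of "br x (br x z)" "k *\<^sub>R z"] by (simp add: f(3) linear_scale[OF f(1)])
  then have "(\<exists>z'. z' \<noteq> 0 \<and> br' (f x) (br' (f x) z') = k *\<^sub>R z')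
      \<longleftrightarrow> (\<exists>z. z \<noteq> 0 \<and> br x (br x z) = k *\<^sub>R z)" for x k
    using surj f0 by metis
  then have "ad_sq_spec br' (f x) = ad_sq_spec br x" for x
    by (simp add: ad_sq_spec_def)
  then have "range (ad_sq_spec br) = ad_sq_spec br' ` range f"
    by (simp add: image_image)
  then show "range (ad_sq_spec br) = range (ad_sq_spec br')"
    using f(2) by (simp add: bij_is_surj)
  show "has_centre br \<longleftrightarrow> has_centre br'"
  proof -
    have "(\<forall>x'. br' x' (f z) = 0) \<longleftrightarrow> (\<forall>x. br x z = 0)" for z
      using surj f0 f(3) by metis
    then show ?thesis
      unfolding has_centre_def using surj f0 by metis
  qed
qed

text \<open>The nonzero eigenvalues of the squared matrix of the acting vector:
  \<open>R_mat b\<close> contributes the negative of the square of \<open>b\<close>, the scalar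
  block contributes \<open>1\<close>.\<close>

fun label_spec :: "label \<Rightarrow> real set" where
  "label_spec Abelian5 = {}"
| "label_spec G10 = {-1}"
| "label_spec (G1 a) = {-1, -(a\<^sup>2)}"
| "label_spec R_times_rr30 = {1}"
| "label_spec (R_times_r'40 l) = {1, -(l\<^sup>2)}"

text \<open>The condition \<open>p * a = 0\<close> kills the off-diagonal entries of the squared
  matrix, so its eigenvalues are its diagonal entries.\<close>

lemma ad_sq_spec_model_bracket:
  assumes "p * a = 0"
  shows "ad_sq_spec (model_bracket p a b) (s, u) = (\<lambda>k. s\<^sup>2 * k) ` {p\<^sup>2 - a\<^sup>2, - (a\<^sup>2), - (b\<^sup>2)} - {0}"
proof (intro set_eqI iffI)
  obtain u1 u2 u3 u4 where u: "u = (u1, u2, u3, u4)" by (cases u)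
  fix k
  { assume "k \<in> ad_sq_spec (model_bracket p a b) (s, u)"
    then obtain t v1 v2 v3 v4 where k: "k \<noteq> 0" and nz: "(t, v1, v2, v3, v4) \<noteq> 0"
      and eq: "model_bracket p a b (s, u) (model_bracket p a b (s, u) (t, v1, v2, v3, v4))
        = k *\<^sub>R (t, v1, v2, v3, v4)"
      unfolding ad_sq_spec_def by auto
    \<comment> \<open>Brackets have first coordinate \<open>0\<close>, so an eigenvector for a
      nonzero eigenvalue lies in the abelian ideal.\<close>
    have t: "t = 0" using eq k by (simp add: u model_bracket_def)
    have "s\<^sup>2 * (p\<^sup>2 - a\<^sup>2) * v1 - p * a * s\<^sup>2 * v2 = k * v1"
      "p * a * s\<^sup>2 * v1 - s\<^sup>2 * a\<^sup>2 * v2 = k * v2"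
      "- s\<^sup>2 * b\<^sup>2 * v3 = k * v3" "- s\<^sup>2 * b\<^sup>2 * v4 = k * v4"
      using eq by (auto simp: t u model_bracket_def algebra_simps power2_eq_square)
    then have "(s\<^sup>2 * (p\<^sup>2 - a\<^sup>2) - k) * v1 = 0" "(s\<^sup>2 * - a\<^sup>2 - k) * v2 = 0"
      "(s\<^sup>2 * - b\<^sup>2 - k) * v3 = 0" "(s\<^sup>2 * - b\<^sup>2 - k) * v4 = 0"
      using assms by (auto simp: algebra_simps)
    then show "k \<in> (\<lambda>k. s\<^sup>2 * k) ` {p\<^sup>2 - a\<^sup>2, - (a\<^sup>2), - (b\<^sup>2)} - {0}"
      using nz t k by (auto simp: zero_prod_def) }
  { assume k: "k \<in> (\<lambda>k. s\<^sup>2 * k) ` {p\<^sup>2 - a\<^sup>2, - (a\<^sup>2), - (b\<^sup>2)} - {0}"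
    have "\<exists>v. v \<noteq> 0 \<and> model_bracket p a b (s, u) (model_bracket p a b (s, u) v) = k *\<^sub>R v"
    proof -
      have "p = 0 \<or> a = 0" using assms by simp
      consider "k = s\<^sup>2 * (p\<^sup>2 - a\<^sup>2)" | "k = - (s\<^sup>2 * a\<^sup>2)" | "k = - (s\<^sup>2 * b\<^sup>2)"
        using k by auto
      then show ?thesis
      proof cases
        case 1
        with \<open>p = 0 \<or> a = 0\<close> show ?thesis
          by (intro exI[of _ "(0, 1, 0, 0, 0)"])
            (auto simp: u model_bracket_def zero_prod_def algebra_simps power2_eq_square)
      next
        case 2
        with \<open>p = 0 \<or> a = 0\<close> show ?thesis
          by (intro exI[of _ "(0, 0, 1, 0, 0)"])
            (auto simp: u model_bracket_def zero_prod_def algebra_simps power2_eq_square)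
      next
        case 3
        then show ?thesis
          by (intro exI[of _ "(0, 0, 0, 1, 0)"])
            (auto simp: u model_bracket_def zero_prod_def algebra_simps power2_eq_square)
      qed
    qed
    then show "k \<in> ad_sq_spec (model_bracket p a b) (s, u)"
      using k unfolding ad_sq_spec_def by auto }
qed

text \<open>The acting coefficient \<open>s\<close> enters only through its square, which takes
  every positive value; \<open>s = 0\<close> accounts for the empty set.\<close>

lemma range_ad_sq_spec_model_of:
  assumes "admissible L"
  shows "range (ad_sq_spec (model_of L)) = insert {} {(\<lambda>k. r * k) ` label_spec L | r. r > 0}"
proof -
  have *: "ad_sq_spec (model_of L) (s, u) = (if s = 0 then {} else (\<lambda>k. s\<^sup>2 * k) ` label_spec L)"
    for s u
    using assms by (cases L) (auto simp: ad_sq_spec_model_bracket)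
  show ?thesis
  proof (intro equalityI subsetI)
    fix S assume "S \<in> range (ad_sq_spec (model_of L))"
    then obtain s u where "S = ad_sq_spec (model_of L) (s, u)" by auto
    then show "S \<in> insert {} {(\<lambda>k. r * k) ` label_spec L | r. r > 0}"
      by (cases "s = 0") (auto simp: * intro!: exI[of _ "s\<^sup>2"])
  next
    fix S assume "S \<in> insert {} {(\<lambda>k. r * k) ` label_spec L | r. r > 0}"
    then consider "S = {}" | r where "r > 0" "S = (\<lambda>k. r * k) ` label_spec L" by auto
    then show "S \<in> range (ad_sq_spec (model_of L))"
    proof cases
      case 1
      then show ?thesis by (intro range_eqI[of _ _ "(0, 0)"]) (simp add: *)
    next
      case 2
      then show ?thesis by (intro range_eqI[of _ _ "(sqrt r, 0)"]) (simp add: *)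
    qed
  qed
qed

lemma label_spec_nonempty_iff: "label_spec L = {} \<longleftrightarrow> L = Abelian5"
  by (cases L) auto

lemma has_centre_model_of:
  assumes "admissible L"
  shows "has_centre (model_of L) \<longleftrightarrow> (\<forall>a. L \<noteq> G1 a)"
proof (cases L)
  case (G1 a)
  have "z = 0" if "\<forall>x. model_bracket 0 1 a x z = 0" for z
  proof -
    obtain t v1 v2 v3 v4 where z: "z = (t, v1, v2, v3, v4)" by (cases z)
    \<comment> \<open>Commuting with the acting vector forces the last four coordinates to vanish,
      as its matrix is invertible; commuting with a vector of the ideal then forces
      \<open>t = 0\<close>.\<close>
    show ?thesis
      using that[rule_format, of "(1, 0, 0, 0, 0)"] that[rule_format, of "(0, 1, 0, 0, 0)"] assms G1
      by (auto simp: z model_bracket_def zero_prod_def)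
  qed
  then show ?thesis using G1 by (auto simp: has_centre_def)
next
  case (R_times_r'40 l)
  then show ?thesis
    by (auto simp: has_centre_def model_bracket_def zero_prod_def
        intro!: exI[of _ "(0, 0, 1, 0, 0) :: tuple5"] simp del: split_paired_Ex)
qed (auto simp: has_centre_def model_bracket_def zero_prod_def
    intro!: exI[of _ "(0, 0, 0, 1, 0) :: tuple5"] simp del: split_paired_Ex)

lemma pair_scaling_eq:
  fixes a b r :: real
  assumes "{- 1, - (a\<^sup>2)} = (\<lambda>k. r * k) ` {- 1, - (b\<^sup>2)}"
    and "0 < a" "a \<le> 1" "0 < b" "b \<le> 1"
  shows "a = b"
proof -
  have le: "a\<^sup>2 \<le> 1" "b\<^sup>2 \<le> 1" "0 < b\<^sup>2" using assms by (auto simp: power_le_one)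
  have 1: "1 = r \<or> 1 = r * b\<^sup>2" "a\<^sup>2 = r \<or> a\<^sup>2 = r * b\<^sup>2" "r = 1 \<or> r = a\<^sup>2"
    "r * b\<^sup>2 = 1 \<or> r * b\<^sup>2 = a\<^sup>2"
    using assms(1) by (auto simp: doubleton_eq_iff)
  have "a\<^sup>2 = b\<^sup>2"
  proof (cases "r = 1")
    case True
    then show ?thesis using 1 by auto
  next
    \<comment> \<open>Otherwise the scaling exchanges the two entries, so \<open>1\<close> is the
      product of two numbers at most \<open>1\<close>, whence \<open>r = 1\<close> after
      all.\<close>
    case False
    then have "r = a\<^sup>2" "1 = a\<^sup>2 * b\<^sup>2" using 1 by auto
    moreover have "a\<^sup>2 * b\<^sup>2 \<le> a\<^sup>2" using le by (simp add: mult_left_le)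
    ultimately show ?thesis using le False by auto
  qed
  then show ?thesis using assms by (simp add: power2_eq_iff)
qed

text \<open>The spectrum of \<open>L\<close> occurs with factor \<open>1\<close> on one side, hence
  with some factor on the other; being nonempty, it is not the spectrum of an ideal element.\<close>

lemma label_spec_scaling:
  assumes "admissible L" "admissible L'" "lie_isomorphic (model_of L) (model_of L')"
    and "L \<noteq> Abelian5"
  shows "\<exists>r>0. label_spec L = (\<lambda>k. r * k) ` label_spec L'"
proof -
  have "label_spec L = (\<lambda>k. 1 * k) ` label_spec L" by simp
  then have "label_spec L \<in> range (ad_sq_spec (model_of L))"
    unfolding range_ad_sq_spec_model_of[OF assms(1)] using zero_less_one by blast
  then have "label_spec L \<in> range (ad_sq_spec (model_of L'))"
    using lie_isomorphic_invariants(1)[OF assms(3)] by simp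
  then show ?thesis
    using assms(4) unfolding range_ad_sq_spec_model_of[OF assms(2)] label_spec_nonempty_iff[symmetric]
    by blast
qed

text \<open>Taking \<open>br\<close> to be a member of the list turns this into non-isomorphism for
  different parameters.\<close>

lemma label_unique:
  assumes "admissible L" "admissible L'" "isomorphic_to br L" "isomorphic_to br L'"
  shows "L = L'"
proof -
  have iso: "lie_isomorphic (model_of L) (model_of L')"
    using assms lie_isomorphic_sym lie_isomorphic_trans unfolding isomorphic_to_iff_model by blast
  have centre: "(\<exists>a. L = G1 a) \<longleftrightarrow> (\<exists>a. L' = G1 a)"
    using lie_isomorphic_invariants(2)[OF iso] has_centre_model_of assms by blast
  show ?thesis
  proof (cases "L = Abelian5 \<or> L' = Abelian5")
    case True
    then show ?thesis
      using label_spec_scaling[OF assms(1,2) iso] label_spec_nonempty_iff[of L]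
        label_spec_scaling[OF assms(2,1) lie_isomorphic_sym[OF iso]] label_spec_nonempty_iff[of L']
      by (metis image_is_empty)
  next
    case False
    then obtain r where r: "r > 0" "label_spec L = (\<lambda>k. r * k) ` label_spec L'"
      using label_spec_scaling[OF assms(1,2) iso] by auto
    show ?thesis
    proof (cases "\<exists>a. L = G1 a")
      case True
      then obtain a b where "L = G1 a" "L' = G1 b" using centre by auto
      then show ?thesis using r pair_scaling_eq[of a r b] assms by auto
    next
      case nG: False
      then have nG': "\<nexists>a. L' = G1 a" using centre by auto
      \<comment> \<open>Once \<open>G1\<close> and the abelian algebra are set aside, the signs
        occurring in the spectrum fix the label up to the parameter of \<open>R_times_r'40\<close>;
        positive scaling preserves them.\<close>
      have pos: "(\<exists>k\<in>label_spec M. k > 0) \<longleftrightarrow> M = R_times_rr30 \<or> (\<exists>l. M = R_times_r'40 l)" for M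
        by (cases M) auto
      have neg: "(\<exists>k\<in>label_spec M. k < 0) \<longleftrightarrow> M = G10 \<or> (\<exists>l. M = R_times_r'40 l)"
        if "admissible M" "\<nexists>a. M = G1 a" for M
        using that by (cases M) auto
      have "(\<exists>k\<in>label_spec L. k > 0) \<longleftrightarrow> (\<exists>k\<in>label_spec L'. k > 0)"
        "(\<exists>k\<in>label_spec L. k < 0) \<longleftrightarrow> (\<exists>k\<in>label_spec L'. k < 0)"
        using r by (auto simp: zero_less_mult_iff mult_less_0_iff)
      then have "L = L' \<or> (\<exists>l m. L = R_times_r'40 l \<and> L' = R_times_r'40 m)"
        unfolding pos neg[OF assms(1) nG] neg[OF assms(2) nG'] using False nG nG'
        by (cases L; cases L') auto
      then consider "L = L'" | l m where "L = R_times_r'40 l" "L' = R_times_r'40 m" by auto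
      then show ?thesis
      proof cases
        case (2 l m)
        then have lm: "0 < l" "0 < m" using assms by auto
        have eq: "{1, - (l\<^sup>2)} = {r, - (r * m\<^sup>2)}" using r 2 by auto
        \<comment> \<open>By sign, the positive entries must match each other, which gives
          \<open>r = 1\<close>.\<close>
        have "- (l\<^sup>2) < 0" "- (r * m\<^sup>2) < 0" using lm r by auto
        then have "1 = r \<and> l\<^sup>2 = r * m\<^sup>2"
          using eq r(1) unfolding doubleton_eq_iff by linarith
        then have "l\<^sup>2 = m\<^sup>2" by simp
        then show ?thesis using 2 lm by (simp add: power2_eq_iff)
      qed
    qed
  qed
qed

section \<open>Orthogonal families for an abstract inner product\<close>

text \<open>An infinite basis would have \<open>card\<close> equal to \<open>0\<close>, so positive
  dimension forces finiteness.\<close>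

lemma finite_dim_basis:
  assumes "dim (UNIV :: ('a::real_vector) set) > 0"
  obtains B :: "('a::real_vector) set" where "finite B" "span B = UNIV" "card B = dim (UNIV :: ('a::real_vector) set)"
  using assms basis_exists[of "UNIV :: ('a::real_vector) set"] by (metis card_ge_0_finite top.extremum_uniqueI)

lemma independent_card_le_dim_UNIV:
  fixes S :: "'a::real_vector set"
  assumes "dim (UNIV :: 'a set) > 0" "independent S"
  shows "finite S" "card S \<le> dim (UNIV :: 'a set)"
  using finite_dim_basis[OF assms(1)] independent_span_bound[OF _ assms(2)] by (metis subset_UNIV)+

lemma span_card_ge_dim_UNIV:
  fixes S :: "'a::real_vector set"
  assumes "dim (UNIV :: 'a set) > 0" "finite S" "span S = UNIV"
  shows "dim (UNIV :: 'a set) \<le> card S"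
  using basis_exists[of "UNIV :: 'a set"] independent_span_bound[OF assms(2)] assms(3)
  by (metis subset_UNIV)

text \<open>The metric is part of the coKaehler data, so orthogonality is developed for an arbitrary
  \<open>g\<close>; \<open>dim_pos\<close> supplies finite dimension.\<close>

locale inner_product_space =
  fixes g :: "'a::real_vector \<Rightarrow> 'a \<Rightarrow> real"
  assumes inner_product: "inner_product g"
    and dim_pos: "dim (UNIV :: 'a set) > 0"
begin

lemma bilinear: "bilinear g"
  using inner_product by (simp add: inner_product_def)

lemmas g_simps =
  bilinear_ladd[OF bilinear] bilinear_radd[OF bilinear] bilinear_lmul[OF bilinear]
  bilinear_rmul[OF bilinear] bilinear_lneg[OF bilinear] bilinear_rneg[OF bilinear]
  bilinear_lsub[OF bilinear] bilinear_rsub[OF bilinear] bilinear_lzero[OF bilinear]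
  bilinear_rzero[OF bilinear]

lemma commute: "g x y = g y x"
  using inner_product by (simp add: inner_product_def)

lemma self_eq_0_iff [simp]: "g x x = 0 \<longleftrightarrow> x = 0"
  using inner_product g_simps(9) by (force simp: inner_product_def)

lemma self_pos: "x \<noteq> 0 \<Longrightarrow> g x x > 0"
  using inner_product by (simp add: inner_product_def)

lemma linear_left: "linear (\<lambda>x. g x y)"
  using bilinear by (simp add: bilinear_def)

definition orthogonal_family :: "'a set \<Rightarrow> bool" where
  "orthogonal_family E \<longleftrightarrow>
     finite E \<and> 0 \<notin> E \<and> (\<forall>x\<in>E. \<forall>y\<in>E. x \<noteq> y \<longrightarrow> g x y = 0)"

lemma orthogonal_family_insert:
  assumes "orthogonal_family E" "x \<noteq> 0" "\<forall>e\<in>E. g x e = 0"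
  shows "orthogonal_family (insert x E)"
  using assms commute unfolding orthogonal_family_def by auto

lemma sum_orthogonal:
  assumes "orthogonal_family E" "e \<in> E"
  shows "g (\<Sum>x\<in>E. c x *\<^sub>R x) e = c e * g e e"
proof -
  have "g (\<Sum>x\<in>E. c x *\<^sub>R x) e = (\<Sum>x\<in>E. c x * g x e)"
    by (simp add: linear_sum[OF linear_left] g_simps)
  also have "\<dots> = (\<Sum>x\<in>E. if x = e then c x * g x e else 0)"
    using assms by (intro sum.cong) (auto simp: orthogonal_family_def)
  also have "\<dots> = c e * g e e"
    using assms by (simp add: orthogonal_family_def)
  finally show ?thesis .
qed

lemma independent_orthogonal_family:
  assumes E: "orthogonal_family E"
  shows "independent E"
proof -
  have fin: "finite E" and nz: "0 \<notin> E" using E by (auto simp: orthogonal_family_def)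
  have "c e = 0" if "(\<Sum>x\<in>E. c x *\<^sub>R x) = 0" "e \<in> E" for c e
    using sum_orthogonal[OF E that(2), of c] that nz by (auto simp: g_simps)
  then show ?thesis
    unfolding dependent_finite[OF fin] by blast
qed

lemma orthogonal_projection:
  assumes E: "orthogonal_family E"
  obtains p where "p \<in> span E" "\<forall>e\<in>E. g (y - p) e = 0"
proof
  let ?p = "\<Sum>x\<in>E. (g y x / g x x) *\<^sub>R x"
  show "?p \<in> span E" by (intro span_sum span_scale span_base)
  show "\<forall>e\<in>E. g (y - ?p) e = 0"
  proof
    fix e assume e: "e \<in> E"
    then have "e \<noteq> 0" using E by (auto simp: orthogonal_family_def)
    then show "g (y - ?p) e = 0"
      using sum_orthogonal[OF E e, of "\<lambda>x. g y x / g x x"] by (simp add: g_simps)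
  qed
qed

text \<open>Too few vectors cannot span; the residue of a projection is the vector sought.\<close>

lemma exists_orthogonal:
  assumes E: "orthogonal_family E" and "card E < dim (UNIV :: 'a set)"
  obtains v where "v \<noteq> 0" "\<forall>e\<in>E. g v e = 0"
proof -
  have "span E \<noteq> UNIV"
    using span_card_ge_dim_UNIV[OF dim_pos, of E] assms by (auto simp: orthogonal_family_def)
  then obtain y where y: "y \<notin> span E" by auto
  obtain p where p: "p \<in> span E" "\<forall>e\<in>E. g (y - p) e = 0"
    by (rule orthogonal_projection[OF E])
  show thesis
    using p y by (intro that[of "y - p"]) auto
qed

lemma orthogonal_family_complete:
  assumes E: "orthogonal_family E" and card: "card E = dim (UNIV :: 'a set)"
    and y: "\<forall>e\<in>E. g y e = 0"
  shows "y = 0"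
proof (rule ccontr)
  assume "y \<noteq> 0"
  then have "y \<notin> E" using y by auto
  have "independent (insert y E)"
    using independent_orthogonal_family orthogonal_family_insert[OF E \<open>y \<noteq> 0\<close> y] by blast
  then have "card (insert y E) \<le> dim (UNIV :: 'a set)"
    by (rule independent_card_le_dim_UNIV[OF dim_pos])
  then show False
    using card \<open>y \<notin> E\<close> E by (simp add: orthogonal_family_def)
qed

text \<open>A largest orthogonal family inside \<open>I\<close> spans \<open>I\<close>, since a
  projection residue would enlarge it. One more orthogonal vector \<open>n\<close> completes it to a
  basis of the whole space.\<close>

lemma hyperplane_normal:
  assumes I: "subspace I" and dim: "dim (UNIV :: 'a set) = dim I + 1"
  obtains n where "n \<noteq> 0" "\<And>y. y \<in> I \<longleftrightarrow> g y n = 0"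
proof -
  let ?P = "\<lambda>E. orthogonal_family E \<and> E \<subseteq> I"
  have "?P {}" by (auto simp: orthogonal_family_def)
  moreover have "card E < Suc (dim (UNIV :: 'a set))" if "?P E" for E
    using that independent_card_le_dim_UNIV[OF dim_pos] independent_orthogonal_family
    by (simp add: less_Suc_eq_le)
  ultimately obtain E where E: "?P E" and max: "\<And>F. ?P F \<Longrightarrow> card F \<le> card E"
    using ex_has_greatest_nat[of ?P "{}" card "Suc (dim (UNIV :: 'a set))"] by (metis less_imp_le)
  have fin: "finite E" using E by (simp add: orthogonal_family_def)
  have EI: "span E \<subseteq> I" using E I by (simp add: span_minimal)
  have "I \<subseteq> span E"
  proof
    fix y assume "y \<in> I"
    obtain p where p: "p \<in> span E" "\<forall>e\<in>E. g (y - p) e = 0"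
      using E orthogonal_projection by blast
    have "y - p = 0"
    proof (rule ccontr)
      assume nz: "y - p \<noteq> 0"
      have "y - p \<in> I" using \<open>y \<in> I\<close> p EI I by (auto intro: subspace_diff)
      then have "?P (insert (y - p) E)" using orthogonal_family_insert nz p E by blast
      moreover have "y - p \<notin> E" using nz p by auto
      ultimately show False using max[of "insert (y - p) E"] fin by simp
    qed
    then show "y \<in> span E" using p by simp
  qed
  then have span: "span E = I" using EI by auto
  have card: "card E = dim I"
    using dim_eq_card[of E I] independent_orthogonal_family E span I by (simp add: span_eq_iff[THEN iffD2])
  then obtain n where n: "n \<noteq> 0" "\<forall>e\<in>E. g n e = 0"
    using exists_orthogonal[of E] E dim by auto
  have "n \<notin> E" using n by auto
  have ortho_n: "orthogonal_family (insert n E)" using orthogonal_family_insert n E by blast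
  show thesis
  proof (rule that[OF n(1)])
    fix y
    show "y \<in> I \<longleftrightarrow> g y n = 0"
    proof
      have "E \<subseteq> {x. g x n = 0}" "subspace {x. g x n = 0}"
        using n commute by (auto simp: g_simps intro!: subspaceI)
      then have "span E \<subseteq> {x. g x n = 0}" by (rule span_minimal)
      then show "y \<in> I \<Longrightarrow> g y n = 0" using span by auto
    next
      assume y: "g y n = 0"
      obtain p where p: "p \<in> span E" "\<forall>e\<in>E. g (y - p) e = 0"
        using E orthogonal_projection by blast
      have "g p n = 0"
      proof -
        have "E \<subseteq> {x. g x n = 0}" "subspace {x. g x n = 0}"
          using n commute by (auto simp: g_simps intro!: subspaceI)
        then have "span E \<subseteq> {x. g x n = 0}" by (rule span_minimal)
        then show ?thesis using p by auto
      qed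
      \<comment> \<open>The residue is orthogonal to a complete family, so \<open>y\<close> equals
        its projection to \<open>I\<close>.\<close>
      then have "\<forall>e\<in>insert n E. g (y - p) e = 0" using p y by (simp add: g_simps)
      then have "y - p = 0"
        using card dim fin \<open>n \<notin> E\<close> by (intro orthogonal_family_complete[OF ortho_n]) auto
      then show "y \<in> I" using p span by simp
    qed
  qed
qed

lemma orthogonal5_complete:
  assumes "dim (UNIV :: 'a set) = 5"
    and nz: "a \<noteq> 0" "b \<noteq> 0" "c \<noteq> 0" "d \<noteq> 0" "e \<noteq> 0"
    and orth: "g b a = 0" "g c a = 0" "g c b = 0" "g d a = 0" "g d b = 0" "g d c = 0"
      "g e a = 0" "g e b = 0" "g e c = 0" "g e d = 0"
    and y: "g y a = 0" "g y b = 0" "g y c = 0" "g y d = 0" "g y e = 0"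
  shows "y = 0"
proof -
  have "orthogonal_family {e, d, c, b, a}"
    using nz orth by (intro orthogonal_family_insert) (auto simp: orthogonal_family_def)
  moreover have "card {e, d, c, b, a} = 5"
  proof -
    have "a \<notin> {}" "b \<notin> {a}" "c \<notin> {b, a}" "d \<notin> {c, b, a}" "e \<notin> {d, c, b, a}"
      using nz orth by auto
    then show ?thesis by simp
  qed
  ultimately show ?thesis
    using orthogonal_family_complete[of "{e, d, c, b, a}" y] assms(1) y by auto
qed

end

section \<open>The structure of an almost abelian coKaehler algebra\<close>

lemma alternating_imp_anti:
  assumes "bilinear br" "\<And>x. br x x = 0"
  shows "br y z = - br z y"
proof -
  have "br (y + z) (y + z) = br y (y + z) + br z (y + z)"
    by (rule bilinear_ladd[OF assms(1)])
  also have "\<dots> = br y z + br z y"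
    by (simp add: bilinear_radd[OF assms(1)] assms(2))
  finally have "br y z + br z y = 0"
    by (metis assms(2))
  then show ?thesis by (simp only: eq_neg_iff_add_eq_0)
qed

text \<open>Coordinates with respect to \<open>x\<close>, \<open>u1\<close>, \<open>u2\<close>,
  \<open>u3\<close>, \<open>u4\<close> give the isomorphism; independence suffices because the
  dimension is five.\<close>

lemma model_bracket_iso:
  fixes br :: "'a::real_vector \<Rightarrow> 'a \<Rightarrow> 'a"
  assumes br: "bilinear br" "\<And>x. br x x = 0"
    and dim: "dim (UNIV :: 'a set) = 5"
    and indep: "\<And>s c1 c2 c3 c4. s *\<^sub>R x + c1 *\<^sub>R u1 + c2 *\<^sub>R u2 + c3 *\<^sub>R u3 + c4 *\<^sub>R u4 = 0
      \<Longrightarrow> s = 0 \<and> c1 = 0 \<and> c2 = 0 \<and> c3 = 0 \<and> c4 = 0"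
    and abelian: "br u1 u2 = 0" "br u1 u3 = 0" "br u1 u4 = 0" "br u2 u3 = 0" "br u2 u4 = 0"
      "br u3 u4 = 0"
    and action: "br x u1 = p *\<^sub>R u1 + a *\<^sub>R u2" "br x u2 = - a *\<^sub>R u1" "br x u3 = b *\<^sub>R u4"
      "br x u4 = - b *\<^sub>R u3"
  shows "lie_isomorphic br (model_bracket p a b)"
proof -
  note anti = alternating_imp_anti[OF br]
  define F where "F = (\<lambda>(s, c1, c2, c3, c4).
    s *\<^sub>R x + c1 *\<^sub>R u1 + c2 *\<^sub>R u2 + c3 *\<^sub>R u3 + c4 *\<^sub>R (u4 :: 'a))"
  have lin: "linear F"
    by (rule linearI) (auto simp: F_def algebra_simps)
  have "v = 0" if "F v = 0" for v
  proof -
    obtain s c1 c2 c3 c4 where v: "v = (s, c1, c2, c3, c4)" by (cases v)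
    show ?thesis
      using indep[of s c1 c2 c3 c4] that by (simp add: v F_def zero_prod_def)
  qed
  then have inj: "inj F"
    using linear_injective_0[OF lin] by blast
  have surj: "surj F"
  proof -
    have ind: "independent (F ` Basis)"
      using inj by (intro linear_independent_injective_image[OF lin independent_Basis])
        (rule inj_on_subset, auto)
    have "card (F ` Basis) = DIM(tuple5)"
      using inj by (intro card_image) (rule inj_on_subset, auto)
    also have "\<dots> = 5"
      by (simp only: DIM_prod DIM_real)
    finally have card: "card (F ` Basis) = 5" .
    \<comment> \<open>A vector outside the span would yield six independent vectors.\<close>
    have "y \<in> span (F ` Basis)" for y
    proof (rule ccontr)
      assume y: "y \<notin> span (F ` Basis)"
      then have "y \<notin> F ` Basis" by (rule contrapos_nn) (rule span_base)
      moreover have "card (insert y (F ` Basis)) \<le> 5"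
        using independent_card_le_dim_UNIV(2)[OF _ independent_insertI[OF y ind]] dim by auto
      moreover have "finite (F ` Basis)" by simp
      ultimately have "Suc (card (F ` Basis)) \<le> 5" by (metis card_insert_disjoint)
      then show False unfolding card by simp
    qed
    then show ?thesis
      using linear_span_image[OF lin, of Basis] by auto
  qed
  have hom: "F (model_bracket p a b v w) = br (F v) (F w)" for v w
  proof -
    obtain s c1 c2 c3 c4 where v: "v = (s, c1, c2, c3, c4)" by (cases v)
    obtain t d1 d2 d3 d4 where w: "w = (t, d1, d2, d3, d4)" by (cases w)
    have flip: "br u2 u1 = 0" "br u3 u1 = 0" "br u4 u1 = 0" "br u3 u2 = 0" "br u4 u2 = 0"
      "br u4 u3 = 0" "br u1 x = - br x u1" "br u2 x = - br x u2" "br u3 x = - br x u3"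
      "br u4 x = - br x u4"
      using abelian anti[of u2 u1] anti[of u3 u1] anti[of u4 u1] anti[of u3 u2] anti[of u4 u2]
        anti[of u4 u3] anti[of u1 x] anti[of u2 x] anti[of u3 x] anti[of u4 x] by auto
    show ?thesis
      by (simp add: v w F_def model_bracket_def bilinear_ladd[OF br(1)] bilinear_radd[OF br(1)]
          bilinear_lmul[OF br(1)] bilinear_rmul[OF br(1)] abelian flip br(2) action)
        (simp add: algebra_simps)
  qed
  have "lie_isomorphic (model_bracket p a b) br"
    unfolding lie_isomorphic_def using lin inj surj hom by (auto simp: bij_def)
  then show ?thesis by (rule lie_isomorphic_sym)
qed

locale cokaehler5 = inner_product_space g for g :: "'a::real_vector \<Rightarrow> 'a \<Rightarrow> real" +
  fixes br :: "'a \<Rightarrow> 'a \<Rightarrow> 'a" and J :: "'a \<Rightarrow> 'a" and \<xi> :: 'a and \<alpha> :: "'a \<Rightarrow> real"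
  assumes lie: "lie_algebra br"
    and cok: "cokaehler_structure br J \<xi> \<alpha> g"
    and dim5: "dim (UNIV :: 'a set) = 5"
begin

section \<open>Identities for \<open>J\<close>, the metric and \<open>ad \<xi>\<close>\<close>

lemma bilinear_br: "bilinear br" and br_self [simp]: "br x x = 0"
  using lie by (auto simp: lie_algebra_def)

lemmas br_simps =
  bilinear_ladd[OF bilinear_br] bilinear_radd[OF bilinear_br] bilinear_lmul[OF bilinear_br]
  bilinear_rmul[OF bilinear_br] bilinear_lneg[OF bilinear_br] bilinear_rneg[OF bilinear_br]
  bilinear_lsub[OF bilinear_br] bilinear_rsub[OF bilinear_br] bilinear_lzero[OF bilinear_br]
  bilinear_rzero[OF bilinear_br]

lemma br_anti: "br y z = - br z y"
  by (rule alternating_imp_anti[OF bilinear_br]) simp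

lemma linear_J: "linear J" and linear_\<alpha>: "linear \<alpha>" and \<xi>_nz: "\<xi> \<noteq> 0"
  and \<alpha>_\<xi> [simp]: "\<alpha> \<xi> = 1"
  and J_J: "J (J x) = - x + \<alpha> x *\<^sub>R \<xi>"
  and g_J_J: "g (J x) (J y) = g x y - \<alpha> x * \<alpha> y"
  and \<alpha>_br [simp]: "\<alpha> (br x y) = 0"
  and nijenhuis: "br (J x) (J y) - J (br (J x) y) - J (br x (J y)) + J (J (br x y)) = 0"
  and d_omega: "- g (J (br x y)) z + g (J (br x z)) y - g (J (br y z)) x = 0"
  using cok by (auto simp: cokaehler_structure_def ce_d1_def nijenhuis_def ce_d2_def)

lemmas J_simps = linear_add[OF linear_J] linear_diff[OF linear_J] linear_neg[OF linear_J]
  linear_scale[OF linear_J] linear_0[OF linear_J]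
lemmas \<alpha>_simps = linear_add[OF linear_\<alpha>] linear_diff[OF linear_\<alpha>] linear_neg[OF linear_\<alpha>]
  linear_scale[OF linear_\<alpha>] linear_0[OF linear_\<alpha>]

text \<open>The formula for the square of \<open>J\<close> at \<open>J \<xi>\<close> makes
  \<open>J \<xi>\<close> a multiple of \<xi>; applying \<open>J\<close> once more shows that the
  factor squares to zero.\<close>

lemma J_\<xi> [simp]: "J \<xi> = 0"
proof -
  have 0: "J (J \<xi>) = 0" by (simp add: J_J)
  then have "J \<xi> = \<alpha> (J \<xi>) *\<^sub>R \<xi>"
    using J_J[of "J \<xi>"] by (simp add: J_simps)
  then obtain c where c: "J \<xi> = c *\<^sub>R \<xi>" by blast
  then have "(c * c) *\<^sub>R \<xi> = 0" using 0 by (simp add: J_simps)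
  then show ?thesis using \<xi>_nz c by simp
qed

text \<open>The cube of \<open>J\<close> is computed with both groupings and compared.\<close>

lemma \<alpha>_J [simp]: "\<alpha> (J x) = 0"
proof -
  have "J (J (J x)) = - J x" by (simp add: J_J[of x] J_simps)
  then have "\<alpha> (J x) *\<^sub>R \<xi> = 0" by (simp add: J_J[of "J x"])
  then show ?thesis using \<xi>_nz by simp
qed

text \<open>Thus \<xi> is a unit vector and the kernel of \<alpha> is its orthogonal
  complement.\<close>

lemma g_\<xi> [simp]: "g x \<xi> = \<alpha> x" "g \<xi> x = \<alpha> x"
proof -
  have "g x \<xi> = \<alpha> x" for x using g_J_J[of x \<xi>] by (simp add: g_simps)
  then show "g x \<xi> = \<alpha> x" "g \<xi> x = \<alpha> x" using commute[of \<xi> x] by auto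
qed

lemma g_J_left: "g (J x) y = - g x (J y)"
  using g_J_J[of x "J y"] by (simp add: J_J g_simps)

lemma g_J_self [simp]: "g (J x) x = 0" "g x (J x) = 0"
  using g_J_left[of x x] commute[of x "J x"] by auto

lemma J_J_ker: "\<alpha> x = 0 \<Longrightarrow> J (J x) = - x"
  by (simp add: J_J)

lemma J_nz: "\<alpha> x = 0 \<Longrightarrow> x \<noteq> 0 \<Longrightarrow> J x \<noteq> 0"
  using J_J_ker[of x] J_simps(5) by force

text \<open>Since \<open>J \<xi> = 0\<close>, two terms of the Nijenhuis tensor at \<xi> drop out.
  One \<open>J\<close> cancels from the other two, because brackets lie in the kernel of \<alpha>,
  where \<open>J\<close> squares to minus the identity.\<close>

lemma br_\<xi>_J: "br \<xi> (J x) = J (br \<xi> x)"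
proof -
  have "J (br \<xi> (J x)) = J (J (br \<xi> x))"
    using nijenhuis[of \<xi> x] by (simp add: br_simps J_simps)
  then have "J (J (br \<xi> (J x))) = J (J (J (br \<xi> x)))" by simp
  then show ?thesis by (simp add: J_J_ker J_simps)
qed

text \<open>Closedness of the fundamental form is evaluated at \<xi>, \<open>x\<close>,
  \<open>y\<close>; the term with \<open>br x y\<close> vanishes because
  \<open>J \<xi> = 0\<close>.\<close>

lemma J_br_\<xi>_symmetric: "g (J (br \<xi> x)) y = g x (J (br \<xi> y))"
  using d_omega[of \<xi> x y] commute[of x] by (simp add: g_J_left[of _ \<xi>] g_simps)

text \<open>If \<open>v\<close> is orthogonal to the complex line of \<open>u\<close>, so is
  \<open>J v\<close>; hence \<xi>, \<open>u\<close>, \<open>J u\<close>, \<open>v\<close>,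
  \<open>J v\<close> form an orthogonal basis.\<close>

lemma orthogonal_pair_basis:
  assumes "u \<noteq> 0" "v \<noteq> 0" "\<alpha> u = 0" "\<alpha> v = 0" "g v u = 0" "g v (J u) = 0"
    and "\<alpha> y = 0" "g y u = 0" "g y (J u) = 0" "g y v = 0" "g y (J v) = 0"
  shows "y = 0"
proof (rule orthogonal5_complete[OF dim5 \<xi>_nz assms(1) J_nz assms(2) J_nz])
  show "g (J v) (J u) = 0" using assms by (simp add: g_J_J)
  show "g (J v) u = 0" using assms by (simp add: g_J_left g_simps)
qed (use assms in auto)

lemma exists_orthogonal_to_pair:
  assumes "u \<noteq> 0" "\<alpha> u = 0"
  obtains v where "v \<noteq> 0" "\<alpha> v = 0" "g v u = 0" "g v (J u) = 0"
proof -
  have "orthogonal_family {\<xi>}"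
    using \<xi>_nz by (simp add: orthogonal_family_def)
  then have "orthogonal_family {u, \<xi>}"
    using assms by (auto intro!: orthogonal_family_insert[where E = "{\<xi>}"])
  then have ortho: "orthogonal_family {J u, u, \<xi>}"
    using assms J_nz by (auto intro!: orthogonal_family_insert[where E = "{u, \<xi>}"])
  have card: "card {J u, u, \<xi>} < dim (UNIV :: 'a set)"
    using dim5 by (simp add: card_insert_if)
  obtain v where "v \<noteq> 0" "\<forall>e\<in>{J u, u, \<xi>}. g v e = 0"
    by (rule exists_orthogonal[OF ortho card])
  then show thesis
    by (intro that[of v]) auto
qed

text \<open>On the kernel of \<open>\<alpha>\<close> the map \<open>S = - J \<circ> ad \<xi>\<close> is symmetric and commutes with \<open>J\<close>, so it is
  a Hermitian operator on a complex plane; its two eigenvectors are found by hand. Starting from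
  an arbitrary \<open>u\<close>, if \<open>w\<close> is the part of \<open>S u\<close> orthogonal to \<open>u\<close>, then \<open>w + y u\<close> is an eigenvector
  for each root \<open>y\<close> of a quadratic with positive discriminant.\<close>

lemma hermitian_eigenvectors:
  obtains u v a b where "u \<noteq> 0" "v \<noteq> 0" "\<alpha> u = 0" "\<alpha> v = 0" "g v u = 0" "g v (J u) = 0"
    "- J (br \<xi> u) = a *\<^sub>R u" "- J (br \<xi> v) = b *\<^sub>R v"
proof -
  define S where "S = (\<lambda>x. - J (br \<xi> x))"
  have S_simps: "S (x + y) = S x + S y" "S (r *\<^sub>R x) = r *\<^sub>R S x" for x y r
    by (simp_all add: S_def br_simps J_simps)
  have S_sym: "g (S x) y = g x (S y)" for x y
    using J_br_\<xi>_symmetric by (simp add: S_def g_simps)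
  have S_J: "S (J x) = J (S x)" for x
    by (simp add: S_def br_\<xi>_J J_simps)
  have S_\<alpha>: "\<alpha> (S x) = 0" for x
    by (simp add: S_def \<alpha>_simps)
  \<comment> \<open>Symmetry of \<open>S\<close>, its commutation with \<open>J\<close> and skewness
    of \<open>J\<close> show that this number equals its own negative.\<close>
  have S_Jx: "g (S x) (J x) = 0" for x
    using S_sym[of x "J x"] g_J_left[of x "S x"] commute[of "S x" "J x"] by (simp add: S_J)
  have ortho1: "orthogonal_family {\<xi>}"
    using \<xi>_nz by (simp add: orthogonal_family_def)
  obtain u where u: "u \<noteq> 0" "\<alpha> u = 0"
    using exists_orthogonal[OF ortho1] dim5 by auto
  then have guu: "g u u > 0" and guu0: "g u u \<noteq> 0" by (auto simp: self_pos)
  define a where "a = g (S u) u / g u u"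
  define w where "w = S u - a *\<^sub>R u"
  have Su: "S u = a *\<^sub>R u + w" by (simp add: w_def)
  have w\<alpha>: "\<alpha> w = 0" by (simp add: w_def \<alpha>_simps S_\<alpha> u)
  have wu: "g w u = 0" using guu0 by (simp add: w_def a_def g_simps)
  have wJu: "g w (J u) = 0" by (simp add: w_def g_simps S_Jx)
  show thesis
  proof (cases "w = 0")
    case True
    obtain v where v: "v \<noteq> 0" "\<alpha> v = 0" "g v u = 0" "g v (J u) = 0"
      by (rule exists_orthogonal_to_pair[OF u])
    define b where "b = g (S v) v / g v v"
    \<comment> \<open>Here \<open>u\<close> is an eigenvector, so \<open>S\<close> preserves the
      complex line orthogonal to it, which \<open>v\<close> spans; \<open>S_Jx\<close> makes the
      eigenvalue real.\<close>
    have "S v - b *\<^sub>R v = 0"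
    proof (rule orthogonal_pair_basis[OF u(1) v(1) u(2) v(2-4)])
      show "\<alpha> (S v - b *\<^sub>R v) = 0" by (simp add: \<alpha>_simps S_\<alpha> v)
      show "g (S v - b *\<^sub>R v) u = 0" by (simp add: g_simps S_sym Su True v)
      show "g (S v - b *\<^sub>R v) (J u) = 0" by (simp add: g_simps J_simps S_sym S_J Su True v)
      show "g (S v - b *\<^sub>R v) v = 0" using v by (simp add: g_simps b_def)
      show "g (S v - b *\<^sub>R v) (J v) = 0" by (simp add: g_simps S_Jx)
    qed
    then show thesis
      using that[of u v a b] u v Su True by (simp add: S_def)
  next
    case False
    then have gww: "g w w > 0" and gww0: "g w w \<noteq> 0" by (auto simp: self_pos)
    define q where "q = g w w / g u u"
    define d where "d = g (S w) w / g w w"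
    have q: "q > 0" using gww guu by (simp add: q_def)
    have Sw_u: "g (S w) u = g w w"
      by (simp add: S_sym Su g_simps wu)
    \<comment> \<open>The real plane of \<open>u\<close> and \<open>w\<close> is invariant under
      \<open>S\<close>: the components along \<open>J u\<close> and \<open>J w\<close>
      vanish.\<close>
    have "S w - (q *\<^sub>R u + d *\<^sub>R w) = 0"
    proof (rule orthogonal_pair_basis[OF u(1) False u(2) w\<alpha> wu wJu])
      have uJw: "g u (J w) = 0" using wJu commute[of u] g_J_left[of w u] by simp
      show "\<alpha> (S w - (q *\<^sub>R u + d *\<^sub>R w)) = 0" by (simp add: \<alpha>_simps S_\<alpha> u w\<alpha>)
      show "g (S w - (q *\<^sub>R u + d *\<^sub>R w)) u = 0"
        using guu0 by (simp add: g_simps Sw_u q_def wu)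
      show "g (S w - (q *\<^sub>R u + d *\<^sub>R w)) (J u) = 0"
        by (simp add: g_simps J_simps S_sym S_J Su wJu)
      show "g (S w - (q *\<^sub>R u + d *\<^sub>R w)) w = 0"
        using gww0 wu commute[of u w] by (simp add: g_simps d_def)
      show "g (S w - (q *\<^sub>R u + d *\<^sub>R w)) (J w) = 0" by (simp add: g_simps S_Jx uJw)
    qed
    then have Sw: "S w = q *\<^sub>R u + d *\<^sub>R w" by simp
    define r where "r = sqrt ((a - d)\<^sup>2 + 4 * q)"
    have r: "r\<^sup>2 = (a - d)\<^sup>2 + 4 * q" using q by (simp add: r_def)
    have eigen: "S (w + y *\<^sub>R u) = (d + y) *\<^sub>R (w + y *\<^sub>R u)" if "q + y * a = (d + y) * y" for y
    proof -
      have "S (w + y *\<^sub>R u) = (q + y * a) *\<^sub>R u + (d + y) *\<^sub>R w"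
        by (simp add: S_simps Sw Su algebra_simps)
      then show ?thesis unfolding that by (simp add: algebra_simps)
    qed
    \<comment> \<open>These are the roots of the quadratic in \<open>eigen\<close>; their product
      \<open>- q\<close> is what makes the two eigenvectors orthogonal.\<close>
    define y1 y2 where "y1 = (a - d + r) / 2" and "y2 = (a - d - r) / 2"
    have y: "q + y1 * a = (d + y1) * y1" "q + y2 * a = (d + y2) * y2" "y1 * y2 = - q"
      using r by (simp_all add: y1_def y2_def field_simps power2_eq_square)
    have nz: "w + y *\<^sub>R u \<noteq> 0" for y
    proof
      assume "w + y *\<^sub>R u = 0"
      then have "g w (w + y *\<^sub>R u) = 0" by (simp add: g_simps)
      then show False using gww0 wu by (simp add: g_simps)
    qed
    show thesis
    proof (rule that[OF nz nz])
      have uw: "g u w = 0" using wu commute[of u] by simp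
      show "\<alpha> (w + y1 *\<^sub>R u) = 0" "\<alpha> (w + y2 *\<^sub>R u) = 0" by (simp_all add: \<alpha>_simps w\<alpha> u)
      have "y2 * (y1 * g u u) = - g w w" using y(3) guu0 by (simp add: q_def field_simps)
      then show "g (w + y2 *\<^sub>R u) (w + y1 *\<^sub>R u) = 0"
        by (simp add: g_simps wu uw mult.left_commute)
      show "g (w + y2 *\<^sub>R u) (J (w + y1 *\<^sub>R u)) = 0"
        using wJu commute[of u] g_J_left[of w u] by (simp add: g_simps J_simps)
      show "- J (br \<xi> (w + y1 *\<^sub>R u)) = (d + y1) *\<^sub>R (w + y1 *\<^sub>R u)"
        "- J (br \<xi> (w + y2 *\<^sub>R u)) = (d + y2) *\<^sub>R (w + y2 *\<^sub>R u)"
        using eigen[OF y(1)] eigen[OF y(2)] unfolding S_def .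
    qed
  qed
qed

text \<open>An eigenvector \<open>u\<close> of \<open>S\<close> with eigenvalue \<open>a\<close>
  satisfies \<open>br \<xi> u = a *\<^sub>R J u\<close>, so \<xi> acts on the plane of
  \<open>u\<close> and \<open>J u\<close> by \<open>R_mat a\<close>.\<close>

lemma abelian_kernel_model:
  assumes ab: "\<And>x y. \<alpha> x = 0 \<Longrightarrow> \<alpha> y = 0 \<Longrightarrow> br x y = 0"
  obtains a b where "lie_isomorphic br (model_bracket 0 a b)"
proof -
  obtain u v a b where u: "u \<noteq> 0" "\<alpha> u = 0" and v: "v \<noteq> 0" "\<alpha> v = 0"
    and orth: "g v u = 0" "g v (J u) = 0"
    and eig: "- J (br \<xi> u) = a *\<^sub>R u" "- J (br \<xi> v) = b *\<^sub>R v"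
    by (rule hermitian_eigenvectors)
  have act: "br \<xi> x = c *\<^sub>R J x" if "- J (br \<xi> x) = c *\<^sub>R x" for x c
  proof -
    have "J (- J (br \<xi> x)) = c *\<^sub>R J x" unfolding that by (simp add: J_simps)
    then show ?thesis by (simp add: J_simps J_J_ker)
  qed
  note act_u = act[OF eig(1)] and act_v = act[OF eig(2)]
  have orth': "g u v = 0" "g (J v) u = 0" "g u (J v) = 0" "g (J u) v = 0" "g (J v) (J u) = 0"
    "g (J u) (J v) = 0"
    using orth u v commute[of u v] g_J_left[of v u] commute[of u "J v"] commute[of "J u" v]
    by (simp_all add: g_J_J g_simps)
  have "lie_isomorphic br (model_bracket 0 a b)"
  proof (rule model_bracket_iso[of br \<xi> u "J u" v "J v", OF bilinear_br br_self dim5])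
    fix s c1 c2 c3 c4
    assume y: "s *\<^sub>R \<xi> + c1 *\<^sub>R u + c2 *\<^sub>R J u + c3 *\<^sub>R v + c4 *\<^sub>R J v = 0" (is "?y = 0")
    have "\<alpha> ?y = 0" "g ?y u = 0" "g ?y (J u) = 0" "g ?y v = 0" "g ?y (J v) = 0"
      unfolding y by (rule g_simps \<alpha>_simps)+
    then show "s = 0 \<and> c1 = 0 \<and> c2 = 0 \<and> c3 = 0 \<and> c4 = 0"
      using u v orth orth' J_nz by (simp add: g_simps \<alpha>_simps)
  next
    show "br u (J u) = 0" "br u v = 0" "br u (J v) = 0" "br (J u) v = 0" "br (J u) (J v) = 0"
      "br v (J v) = 0"
      using u v by (auto intro: ab)
    show "br \<xi> u = 0 *\<^sub>R u + a *\<^sub>R J u" "br \<xi> v = b *\<^sub>R J v"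
      by (simp_all add: act_u act_v)
    show "br \<xi> (J u) = - a *\<^sub>R u" "br \<xi> (J v) = - b *\<^sub>R v"
      using u v by (simp_all add: br_\<xi>_J act_u act_v J_simps J_J_ker)
  qed
  then show thesis by (rule that)
qed

text \<open>Here \<open>n\<close> is a normal vector of the abelian ideal and \<open>e\<close> its component in the kernel of
  \<open>\<alpha>\<close>. The vector \<open>z\<close> of the ideal turns out to be central.\<close>

lemma nonabelian_kernel_model:
  assumes ideal: "\<And>x y. g y n = 0 \<Longrightarrow> g (br x y) n = 0"
    and ab: "\<And>x y. g x n = 0 \<Longrightarrow> g y n = 0 \<Longrightarrow> br x y = 0"
    and ne: "n - \<alpha> n *\<^sub>R \<xi> \<noteq> 0"
  obtains p b where "lie_isomorphic br (model_bracket p 0 b)"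
proof -
  define e where "e = n - \<alpha> n *\<^sub>R \<xi>"
  have e: "e \<noteq> 0" "\<alpha> e = 0"
    unfolding e_def by (rule ne, simp add: \<alpha>_simps)
  have gee: "g e e \<noteq> 0" using e by simp
  have n: "n = e + \<alpha> n *\<^sub>R \<xi>" by (simp add: e_def)
  have g_n: "g y n = g y e" if "\<alpha> y = 0" for y
    by (subst n) (simp add: g_simps that)
  have br_e: "g (br x y) e = 0" if "g y n = 0" for x y
    using ideal[OF that] g_n by simp
  have br_Je: "g (br x y) e = 0" if "\<alpha> y = 0" "g y e = 0" for x y
    using br_e g_n that by simp
  have ab': "br x y = 0" if "\<alpha> x = 0" "g x e = 0" "\<alpha> y = 0" "g y e = 0" for x y
    using ab g_n that by simp
  obtain w where w: "w \<noteq> 0" "\<alpha> w = 0" "g w e = 0" "g w (J e) = 0"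
    by (rule exists_orthogonal_to_pair[OF e])
  have Jw: "g (J w) e = 0" "g (J w) (J e) = 0"
    using w e by (simp_all add: g_J_left J_J_ker g_simps)
  \<comment> \<open>In the Nijenhuis tensor at \<open>e\<close> and \<open>w\<close>, the brackets
    of \<open>J e\<close> with \<open>w\<close> and \<open>J w\<close> vanish, all three lying in
    the abelian ideal.\<close>
  have br_e_Jw: "br e (J w) = J (br e w)"
  proof -
    have "- J (br e (J w)) + J (J (br e w)) = 0"
      using nijenhuis[of e w] ab'[of "J e" "J w"] ab'[of "J e" w] w Jw by (simp add: J_simps)
    then have "J (J (br e (J w))) = J (J (J (br e w)))" by simp
    then show ?thesis by (simp add: J_J_ker J_simps)
  qed
  \<comment> \<open>The second identity is the ideal property for \<open>br e (J w)\<close>, with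
    \<open>J\<close> moved across the metric.\<close>
  have ew_e: "g (br e w) e = 0" "g (br e w) (J e) = 0"
    using br_Je[of w e] br_Je[of "J w" e] w Jw by (simp_all add: br_e_Jw g_J_left)
  \<comment> \<open>Closedness at \<open>e\<close>, \<open>w\<close>, \<open>J w\<close>: one term
    vanishes and the other two agree.\<close>
  have ew_w: "g (br e w) w = 0"
    using d_omega[of e w "J w"] ab'[of w "J w"] w Jw
    by (simp add: br_e_Jw g_J_J J_J_ker J_simps g_simps)
  define b where "b = g (br e w) (J w) / g (J w) (J w)"
  have "br e w - b *\<^sub>R J w = 0"
    by (rule orthogonal_pair_basis[OF e(1) w(1) e(2) w(2-4)])
      (use w ew_e ew_w Jw J_nz in \<open>simp_all add: \<alpha>_simps g_simps b_def\<close>)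
  then have ew: "br e w = b *\<^sub>R J w" by simp
  then have eJw: "br e (J w) = - b *\<^sub>R w" by (simp add: br_e_Jw J_simps J_J_ker w)
  \<comment> \<open>Closedness at \<open>e\<close>, \<open>J e\<close> and \<open>w\<close> or
    \<open>J w\<close>: the remaining terms pair multiples of \<open>w\<close> and
    \<open>J w\<close> with \<open>J e\<close>.\<close>
  have eJe_w: "g (J (br e (J e))) w = 0" "g (J (br e (J e))) (J w) = 0"
    using d_omega[of e "J e" w] d_omega[of e "J e" "J w"] ab'[of "J e" w] ab'[of "J e" "J w"] w Jw e
    by (simp_all add: ew eJw J_simps g_simps J_J_ker)
  define p where "p = g (br e (J e)) (J e) / g (J e) (J e)"
  have "br e (J e) - p *\<^sub>R J e = 0"
  proof (rule orthogonal_pair_basis[OF e(1) w(1) e(2) w(2-4)])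
    show "g (br e (J e) - p *\<^sub>R J e) e = 0"
      using br_Je[of "J e" e] e by (simp add: g_simps)
    show "g (br e (J e) - p *\<^sub>R J e) (J e) = 0"
      using e J_nz by (simp add: g_simps p_def)
    show "g (br e (J e) - p *\<^sub>R J e) w = 0"
      using eJe_w(2) w commute[of "J e" w] by (simp add: g_simps g_J_J)
    show "g (br e (J e) - p *\<^sub>R J e) (J w) = 0"
      using eJe_w(1) w Jw commute[of "J e" "J w"] by (simp add: g_simps g_J_left)
  qed (simp add: \<alpha>_simps)
  then have eJe: "br e (J e) = p *\<^sub>R J e" by simp
  \<comment> \<open>This value places \<open>z\<close> in the abelian ideal, so \<xi> acts on the
    part of the ideal in the kernel of \<alpha> as \<open>- t\<close> times \<open>e\<close>
    does.\<close>
  define t where "t = - \<alpha> n / g e e"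
  define z where "z = \<xi> + t *\<^sub>R e"
  have zn: "g z n = 0"
    using gee by (simp add: z_def t_def g_simps g_n[OF e(2)])
  have z_ab: "br z y = 0" if "\<alpha> y = 0" "g y e = 0" for y
    using ab[OF zn] g_n that by simp
  have \<xi>_act: "br \<xi> y = - t *\<^sub>R br e y" if "\<alpha> y = 0" "g y e = 0" for y
    using z_ab[OF that] by (simp add: z_def br_simps eq_neg_iff_add_eq_0)
  have "J (br \<xi> e) = - (t * p) *\<^sub>R J e"
    using \<xi>_act[of "J e"] by (simp add: br_\<xi>_J[symmetric] eJe)
  then have "J (J (br \<xi> e)) = J (- (t * p) *\<^sub>R J e)" by simp
  then have "- br \<xi> e = (t * p) *\<^sub>R e"
    by (simp add: J_simps J_J_ker e)
  then have \<xi>e: "br \<xi> e = - (t * p) *\<^sub>R e"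
    by (metis minus_minus scaleR_minus_left)
  \<comment> \<open>The ideal property makes \<open>br e z\<close> orthogonal to \<open>e\<close>,
    but it is a multiple of \<open>e\<close>; so it vanishes and \<open>z\<close> is
    central.\<close>
  have "g (br e z) e = 0" using br_e[OF zn] .
  moreover have ez: "br e z = (t * p) *\<^sub>R e"
    using br_anti[of e \<xi>] \<xi>e by (simp add: z_def br_simps)
  ultimately have tp: "t * p = 0" using gee by (simp add: g_simps)
  have wo: "g e w = 0" "g (J e) w = 0" "g e (J w) = 0" "g (J e) (J w) = 0"
    using w Jw commute by metis+
  have "lie_isomorphic br (model_bracket p 0 b)"
  \<comment> \<open>The acting vector is \<open>e\<close>, and the central \<open>z\<close> takes
    the second place of the first block, where \<open>a = 0\<close>.\<close>
  proof (rule model_bracket_iso[of br e "J e" z w "J w", OF bilinear_br br_self dim5])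
    fix s c1 c2 c3 c4
    assume y: "s *\<^sub>R e + c1 *\<^sub>R J e + c2 *\<^sub>R z + c3 *\<^sub>R w + c4 *\<^sub>R J w = 0" (is "?y = 0")
    have "\<alpha> ?y = 0" "g ?y e = 0" "g ?y (J e) = 0" "g ?y w = 0" "g ?y (J w) = 0"
      unfolding y by (rule g_simps \<alpha>_simps)+
    then show "s = 0 \<and> c1 = 0 \<and> c2 = 0 \<and> c3 = 0 \<and> c4 = 0"
      using e w Jw wo J_nz by (simp add: g_simps \<alpha>_simps z_def)
  qed (use e w Jw ab' z_ab tp br_anti[of "J e" z] in \<open>simp_all add: ew eJw eJe ez\<close>)
  then show thesis by (rule that)
qed

end

section \<open>The classification\<close>

text \<open>A nonzero \<open>p\<close> is scaled to \<open>1\<close>. Otherwise the rotation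
  coefficient of larger absolute value is moved first and scaled to \<open>1\<close>. A reflection
  removes the remaining sign, and zero parameters have their own labels.\<close>

lemma model_bracket_label:
  assumes "p * a = 0"
  obtains L where "admissible L" "lie_isomorphic (model_bracket p a b) (model_of L)"
proof (cases "p = 0")
  case False
  then have a: "a = 0" using assms by simp
  have "lie_isomorphic (model_bracket p a b) (model_bracket 1 0 \<bar>b / p\<bar>)"
    using model_bracket_scale[of "1 / p" p a b] model_bracket_abs[of 1 0 "b / p"] False
      lie_isomorphic_trans by (auto simp: a)
  then show thesis
    using that[of R_times_rr30] that[of "R_times_r'40 \<bar>b / p\<bar>"] False by (cases "b = 0") auto
next
  case True
  note label = that
  have *: thesis
    if le: "\<bar>d\<bar> \<le> \<bar>c\<bar>" and iso: "lie_isomorphic (model_bracket p a b) (model_bracket 0 c d)" for c d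
  proof (cases "c = 0")
    case True
    then show thesis using label[of Abelian5] le iso by auto
  next
    case False
    have "lie_isomorphic (model_bracket 0 c d) (model_bracket 0 1 \<bar>d / c\<bar>)"
      using model_bracket_scale[of "1 / c" 0 c d] model_bracket_abs[of 0 1 "d / c"] False
        lie_isomorphic_trans by auto
    then have "lie_isomorphic (model_bracket p a b) (model_bracket 0 1 \<bar>d / c\<bar>)"
      using lie_isomorphic_trans[OF iso] by blast
    moreover have "\<bar>d / c\<bar> \<le> 1" using le False by (simp add: abs_divide)
    ultimately show thesis
      using label[of G10] label[of "G1 \<bar>d / c\<bar>"]
        False by (cases "d = 0") auto
  qed
  show thesis
  proof (cases "\<bar>b\<bar> \<le> \<bar>a\<bar>")
    case le: True
    then show thesis using *[of b a] lie_isomorphic_refl[of "model_bracket 0 a b"] by (simp add: True)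
  next
    case False
    then show thesis using *[of a b] model_bracket_swap[of a b] by (simp add: True)
  qed
qed

lemma almost_abelian_cokaehler_model:
  fixes br :: "'a::real_vector \<Rightarrow> 'a \<Rightarrow> 'a"
  assumes "lie_algebra br" and dim: "dim (UNIV :: 'a set) = 5"
    and "almost_abelian br" and "admits_cokaehler br"
  obtains p a b where "p * a = 0" "lie_isomorphic br (model_bracket p a b)"
proof -
  obtain J \<xi> \<alpha> g where cok: "cokaehler_structure br J \<xi> \<alpha> g"
    using assms(4) by (auto simp: admits_cokaehler_def)
  then have "inner_product g" by (simp add: cokaehler_structure_def)
  then interpret cokaehler5 g br J \<xi> \<alpha>
    using cok assms by unfold_locales auto
  obtain I where I: "lie_ideal br I" "\<forall>x\<in>I. \<forall>y\<in>I. br x y = 0" "dim (UNIV :: 'a set) = dim I + 1"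
    using assms(3) by (auto simp: almost_abelian_def)
  then have "subspace I" by (simp add: lie_ideal_def)
  then obtain n where n: "n \<noteq> 0" "\<And>y. y \<in> I \<longleftrightarrow> g y n = 0"
    using hyperplane_normal I(3) by blast
  have ab: "br x y = 0" if "g x n = 0" "g y n = 0" for x y
    using I(2) n(2) that by blast
  show thesis
  \<comment> \<open>The vector tested is the component of \<open>n\<close> in the kernel of
    \<alpha>; it vanishes exactly when the ideal is that kernel.\<close>
  proof (cases "n - \<alpha> n *\<^sub>R \<xi> = 0")
    case True
    then have n\<xi>: "n = \<alpha> n *\<^sub>R \<xi>" by simp
    have "g x n = 0" if "\<alpha> x = 0" for x
      by (subst n\<xi>) (simp add: g_simps that)
    then have "\<And>x y. \<alpha> x = 0 \<Longrightarrow> \<alpha> y = 0 \<Longrightarrow> br x y = 0" using ab by blast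
    then obtain a b where "lie_isomorphic br (model_bracket 0 a b)"
      by (rule abelian_kernel_model)
    then show thesis by (rule that[rotated]) simp
  next
    case False
    have "g (br x y) n = 0" if "g y n = 0" for x y
      using I(1) n(2) that unfolding lie_ideal_def by blast
    then obtain p b where "lie_isomorphic br (model_bracket p 0 b)"
      using nonabelian_kernel_model[OF _ ab False] by blast
    then show thesis by (rule that[rotated]) simp
  qed
qed

theorem proposition5p1:
  fixes br :: "'a::real_vector \<Rightarrow> 'a \<Rightarrow> 'a"
  shows "(lie_algebra br \<and> dim (UNIV :: 'a set) = 5 \<and> almost_abelian br \<and> admits_cokaehler br
            \<longrightarrow> (\<exists>!L. admissible L \<and> isomorphic_to br L))
       \<and> (\<forall>a b. 0 < a \<and> a \<le> 1 \<and> 0 < b \<and> b \<le> 1 \<and> a \<noteq> b \<longrightarrow>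
            \<not> lie_isomorphic (g1 a) (g1 b))
       \<and> (\<forall>l m. 0 < l \<and> 0 < m \<and> l \<noteq> m \<longrightarrow>
            \<not> lie_isomorphic (R_times (r'40 l)) (R_times (r'40 m)))"
proof (intro conjI impI allI)
  assume *: "lie_algebra br \<and> dim (UNIV :: 'a set) = 5 \<and> almost_abelian br \<and> admits_cokaehler br"
  then obtain p a b where "p * a = 0" and iso: "lie_isomorphic br (model_bracket p a b)"
    using almost_abelian_cokaehler_model by blast
  from \<open>p * a = 0\<close> obtain L
    where L: "admissible L" "lie_isomorphic (model_bracket p a b) (model_of L)"
    by (rule model_bracket_label)
  then have "isomorphic_to br L"
    using lie_isomorphic_trans[OF iso] by (simp add: isomorphic_to_iff_model)
  then show "\<exists>!L. admissible L \<and> isomorphic_to br L"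
    using L(1) label_unique by blast
next
  fix a b :: real
  assume "0 < a \<and> a \<le> 1 \<and> 0 < b \<and> b \<le> 1 \<and> a \<noteq> b"
  \<comment> \<open>Otherwise \<open>g1 a\<close> would carry two different admissible
    labels.\<close>
  then show "\<not> lie_isomorphic (g1 a) (g1 b)"
    using label_unique[of "G1 a" "G1 b" "g1 a"] lie_isomorphic_refl by auto
next
  fix l m :: real
  assume "0 < l \<and> 0 < m \<and> l \<noteq> m"
  then show "\<not> lie_isomorphic (R_times (r'40 l)) (R_times (r'40 m))"
    using label_unique[of "R_times_r'40 l" "R_times_r'40 m" "R_times (r'40 l)"] lie_isomorphic_refl
    by auto
qed

end
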